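(* Let $H$ be a hypergraph with a minimal non-empty edge cut $F$ such that $|e|=2$ for all $e\in F$. Let $H_i$, for $i\in I$, denote the connected components of $H\setminus F$. For each $i\in I$, let $H_i^*$ be the collapsed hypergraph $H\circ\{V(H_j): j\in I, j\neq i\}$. Then the following hold: (1) $|I|=2$; and (2) writing $I=\{1,2\}$, $H$ has an Euler family if and only if $H_i^*$ has an Euler family for $i=1,2$; likewise, $H$ has a spanning Euler family if and only if $H_i^*$ has a spanning Euler family for $i=1,2$.
   Context: A hypergraph $H=(V,E)$ has a non-empty finite vertex set $V$ and a finite collection $E$ of edges, each associated with a subset of $V$; parallel edges are allowed, so $E$ is a multiset of subsets of $V$. A walk is a sequence $v_0e_1v_1\dots v_{r-1}e_rv_r$ ($r\ge 0$) with $v_{i-1}\ne v_i$ and $v_{i-1},v_i\in e_i$ for all $i=1,\dots,r$; its anchors are $v_0,\dots,v_r$; it is closed if $v_0=v_r$, trivial if $r=0$, and a strict trail if its edges are pairwise distinct. $H$ is connected if any two vertices are joined by a walk; the connected components of $H$ are its maximal connected subhypergraphs $(V',E')$ with $V'\subseteq V$, $E'\subseteq E$, having no empty edges. An Euler family of $H$ is a collection of pairwise edge-disjoint, pairwise anchor-disjoint non-trivial closed strict trails of $H$ jointly traversing every edge of $H$ exactly once; it is spanning if every vertex of $H$ is an anchor of one of its trails. For $\emptyset\neq S\subsetneq V$, the set $[S,\overline S]=\{e\in E: e\cap S\neq\emptyset,\ e\cap\overline S\neq\emptyset\}$, with $\overline S=V\setminus S$, is an edge cut of $H$; an edge cut is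 minimal if it properly contains no edge cut of $H$. $H\setminus F=(V,E\setminus F)$. Collapsed hypergraph: given a partition $\{V_0,V_1,\dots,V_k\}$ of $V$ with $k\ge 1$, the hypergraph $H\circ\{V_1,\dots,V_k\}$ has vertex set $V_0\cup\{v_1,\dots,v_k\}$ for distinct new vertices $v_1,\dots,v_k\notin V$; its edges are obtained by replacing each $e\in E$ by $(e\cap V_0)\cup\{v_i: 1\le i\le k,\ e\cap V_i\neq\emptyset\}$ (one for each $e\in E$, keeping multiplicities), and then discarding those of cardinality less than $2$.
   Formalization: Part (2) is stated under the added assumption that every edge of H has at least two vertices; without it (2) fails, e.g. for V={0,1} with edges {0,1},{0,1},{0}, where both H_i^* have spanning Euler families but H has none. *)

theory Defs
  imports Main
begin

text \<open>Edges are identifiers that \<open>ends\<close> maps to subsets of the vertex set, so parallel edges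
  are distinct identifiers with the same image. Empty and singleton edges are allowed.\<close>

record ('v, 'e) pre_hypergraph =
  verts :: "'v set"
  edges :: "'e set"
  ends :: "'e \<Rightarrow> 'v set"

definition hypergraph :: "('v, 'e) pre_hypergraph \<Rightarrow> bool" where
  "hypergraph H \<longleftrightarrow>
     finite (verts H) \<and> verts H \<noteq> {} \<and> finite (edges H) \<and> (\<forall>e\<in>edges H. ends H e \<subseteq> verts H)"

text \<open>The walk \<open>v\<^sub>0 e\<^sub>1 v\<^sub>1 \<dots> e\<^sub>r v\<^sub>r\<close> is the pair of its anchor list
  \<open>[v\<^sub>0, \<dots>, v\<^sub>r]\<close> and its edge list \<open>[e\<^sub>1, \<dots>, e\<^sub>r]\<close>; the edge \<open>e\<^sub>i\<close> has position \<open>i - 1\<close>.\<close>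

type_synonym ('v, 'e) walk = "'v list \<times> 'e list"

definition walk :: "('v, 'e) pre_hypergraph \<Rightarrow> ('v, 'e) walk \<Rightarrow> bool" where
  "walk H w \<longleftrightarrow> (case w of (vs, es) \<Rightarrow>
     length vs = Suc (length es) \<and> set vs \<subseteq> verts H \<and> set es \<subseteq> edges H \<and>
     (\<forall>i<length es. vs ! i \<noteq> vs ! Suc i \<and>
        vs ! i \<in> ends H (es ! i) \<and> vs ! Suc i \<in> ends H (es ! i)))"

definition anchors :: "('v, 'e) walk \<Rightarrow> 'v set" where
  "anchors w = set (fst w)"

definition walk_edges :: "('v, 'e) walk \<Rightarrow> 'e set" where
  "walk_edges w = set (snd w)"

definition closed_walk :: "('v, 'e) walk \<Rightarrow> bool" where
  "closed_walk w \<longleftrightarrow> hd (fst w) = last (fst w)"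

definition trivial_walk :: "('v, 'e) walk \<Rightarrow> bool" where
  "trivial_walk w \<longleftrightarrow> snd w = []"

definition strict_trail :: "('v, 'e) pre_hypergraph \<Rightarrow> ('v, 'e) walk \<Rightarrow> bool" where
  "strict_trail H w \<longleftrightarrow> walk H w \<and> distinct (snd w)"

definition connected_hypergraph :: "('v, 'e) pre_hypergraph \<Rightarrow> bool" where
  "connected_hypergraph H \<longleftrightarrow>
     (\<forall>u\<in>verts H. \<forall>v\<in>verts H. \<exists>w. walk H w \<and> hd (fst w) = u \<and> last (fst w) = v)"

text \<open>A subhypergraph keeps the whole function \<open>ends\<close>, so that it is determined by its vertex
  set and its edge set.\<close>

definition subhypergraph :: "('v, 'e) pre_hypergraph \<Rightarrow> ('v, 'e) pre_hypergraph \<Rightarrow> bool" where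
  "subhypergraph H' H \<longleftrightarrow>
     hypergraph H' \<and> verts H' \<subseteq> verts H \<and> edges H' \<subseteq> edges H \<and> ends H' = ends H"

text \<open>Maximality is among the connected subhypergraphs without empty edges; an empty edge of the
  hypergraph itself belongs to no component.\<close>

definition conn_sub :: "('v, 'e) pre_hypergraph \<Rightarrow> ('v, 'e) pre_hypergraph \<Rightarrow> bool" where
  "conn_sub H' H \<longleftrightarrow>
     subhypergraph H' H \<and> connected_hypergraph H' \<and> (\<forall>e\<in>edges H'. ends H' e \<noteq> {})"

definition components :: "('v, 'e) pre_hypergraph \<Rightarrow> ('v, 'e) pre_hypergraph set" where
  "components H =
     {C. conn_sub C H \<and> (\<forall>D. conn_sub D H \<and> subhypergraph C D \<longrightarrow> D = C)}"

definition euler_family :: "('v, 'e) pre_hypergraph \<Rightarrow> ('v, 'e) walk set \<Rightarrow> bool" where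
  "euler_family H T \<longleftrightarrow>
     (\<forall>w\<in>T. strict_trail H w \<and> closed_walk w \<and> \<not> trivial_walk w) \<and>
     (\<forall>w\<in>T. \<forall>w'\<in>T. w \<noteq> w' \<longrightarrow>
        walk_edges w \<inter> walk_edges w' = {} \<and> anchors w \<inter> anchors w' = {}) \<and>
     (\<forall>e\<in>edges H. \<exists>!w\<in>T. e \<in> walk_edges w)"

definition spanning_family :: "('v, 'e) pre_hypergraph \<Rightarrow> ('v, 'e) walk set \<Rightarrow> bool" where
  "spanning_family H T \<longleftrightarrow> (\<forall>v\<in>verts H. \<exists>w\<in>T. v \<in> anchors w)"

definition has_euler_family :: "('v, 'e) pre_hypergraph \<Rightarrow> bool" where
  "has_euler_family H \<longleftrightarrow> (\<exists>T. euler_family H T)"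

definition has_spanning_euler_family :: "('v, 'e) pre_hypergraph \<Rightarrow> bool" where
  "has_spanning_euler_family H \<longleftrightarrow> (\<exists>T. euler_family H T \<and> spanning_family H T)"

definition cut :: "('v, 'e) pre_hypergraph \<Rightarrow> 'v set \<Rightarrow> 'e set" where
  "cut H S = {e \<in> edges H. ends H e \<inter> S \<noteq> {} \<and> ends H e \<inter> (verts H - S) \<noteq> {}}"

definition edge_cut :: "('v, 'e) pre_hypergraph \<Rightarrow> 'e set \<Rightarrow> bool" where
  "edge_cut H F \<longleftrightarrow> (\<exists>S. S \<noteq> {} \<and> S \<subset> verts H \<and> F = cut H S)"

definition minimal_edge_cut :: "('v, 'e) pre_hypergraph \<Rightarrow> 'e set \<Rightarrow> bool" where
  "minimal_edge_cut H F \<longleftrightarrow> edge_cut H F \<and> \<not> (\<exists>F'. edge_cut H F' \<and> F' \<subset> F)"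

definition delete_edges ::
  "('v, 'e) pre_hypergraph \<Rightarrow> 'e set \<Rightarrow> ('v, 'e) pre_hypergraph" where
  "delete_edges H F = H\<lparr>edges := edges H - F\<rparr>"

text \<open>The collapsed hypergraph for the set \<open>P\<close> of pairwise disjoint parts
  \<open>V\<^sub>1, \<dots>, V\<^sub>k\<close>; the part \<open>V\<^sub>0\<close> is what remains of the vertex set. A vertex \<open>v\<close> of \<open>V\<^sub>0\<close> is
  \<open>Inl v\<close>, and the new vertex for the part \<open>V\<^sub>i\<close> is \<open>Inr V\<^sub>i\<close>.
  Empty and singleton edges of \<open>H\<close> are discarded as well, although an Euler family of \<open>H\<close>
  would have to traverse them.\<close>

definition collapsed_ends ::
  "('v, 'e) pre_hypergraph \<Rightarrow> 'v set set \<Rightarrow> 'e \<Rightarrow> ('v + 'v set) set" where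
  "collapsed_ends H P e =
     Inl ` (ends H e \<inter> (verts H - \<Union>P)) \<union> Inr ` {W \<in> P. ends H e \<inter> W \<noteq> {}}"

definition collapse ::
  "('v, 'e) pre_hypergraph \<Rightarrow> 'v set set \<Rightarrow> ('v + 'v set, 'e) pre_hypergraph" where
  "collapse H P =
     \<lparr>verts = Inl ` (verts H - \<Union>P) \<union> Inr ` P,
      edges = {e \<in> edges H. card (collapsed_ends H P e) \<ge> 2},
      ends = collapsed_ends H P\<rparr>"

end

theory Submission
  imports Defs
begin

text \<open>
  An Euler family is a matter of parity. If every edge \<open>e\<close> of a hypergraph is replaced by the two
  anchors between which the family traverses it, the outcome is a graph in which all degrees are
  even, since each closed trail enters a vertex as often as it leaves it. Conversely, choose two
  vertices of every edge so that all degrees of the resulting graph are even; then the graph splits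
  into edge-disjoint closed trails, and a splitting into the fewest trails has no two of them with
  a common anchor, because such trails could be joined there. So Euler families correspond to
  these even selections, and their anchors are the selected vertices
  (\<open>euler_family_selection\<close>, \<open>selection_euler_family\<close>).

  Let \<open>A\<close> be one side of a cut whose edges all have two elements. On a cut edge there is no choice
  to make, so an even selection of the hypergraph restricts to each side: all degrees in \<open>A\<close> stay
  the same after the other side is collapsed to a point, and the degree of the new vertex is even
  because the degrees sum to twice the number of edges (\<open>collapse_selection\<close>). In the other
  direction, even selections of the two collapsed hypergraphs are forced on the cut edges and
  therefore glue together (\<open>glue_selections\<close>).

  That there are just two components comes from minimality. If one side \<open>A\<close> fell into two parts
  \<open>X\<close> and \<open>A - X\<close> after deletion of the cut, the cuts around \<open>X\<close> and around \<open>A - X\<close> would lie in the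
  given cut, hence be equal to it, and an edge of the cut would have elements in \<open>X\<close>, in \<open>A - X\<close> and
  outside \<open>A\<close>, which is too many (\<open>side_inseparable\<close>).
\<close>

section \<open>Walks\<close>

lemma walk_Nil [simp]: "walk H (vs, []) \<longleftrightarrow> (\<exists>v\<in>verts H. vs = [v])"
  by (auto simp: walk_def length_Suc_conv)

lemma walk_Cons_iff:
  "walk H (u # x # xs, e # es) \<longleftrightarrow> u \<in> verts H \<and> e \<in> edges H \<and> u \<in> ends H e \<and> x \<in> ends H e \<and>
     u \<noteq> x \<and> walk H (x # xs, es)"
  unfolding walk_def by (auto simp: nth_Cons All_less_Suc2 split: nat.splits)

lemma walk_Cons_edge:
  assumes "walk H (vs, e # es)"
  obtains u x xs where "vs = u # x # xs"
proof -
  have "length vs = Suc (Suc (length es))"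
    using assms by (simp add: walk_def)
  with that show thesis
    by (auto simp: length_Suc_conv)
qed

lemma walk_induct [consumes 1, case_names Nil Cons]:
  assumes "walk H (vs, es)"
    and "\<And>v. v \<in> verts H \<Longrightarrow> P [v] []"
    and "\<And>u x xs e es. \<lbrakk>u \<in> verts H; e \<in> edges H; u \<in> ends H e; x \<in> ends H e; u \<noteq> x;
       walk H (x # xs, es); P (x # xs) es\<rbrakk> \<Longrightarrow> P (u # x # xs) (e # es)"
  shows "P vs es"
  using assms(1)
proof (induction es arbitrary: vs)
  case Nil
  then show ?case using assms(2) by auto
next
  case (Cons e es)
  from Cons.prems obtain u x xs where vs: "vs = u # x # xs"
    by (rule walk_Cons_edge)
  with Cons show ?case
    by (auto simp: walk_Cons_iff intro!: assms(3))
qed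

text \<open>The anchor list of the concatenation is existentially quantified: only the edges and the two end
  points of a walk matter for joining and rotating closed trails.\<close>

lemma walk_append:
  assumes "walk H (vs, es)" "walk H (ws, fs)" "last vs = hd ws"
  shows "\<exists>xs. walk H (xs, es @ fs) \<and> hd xs = hd vs \<and> last xs = last ws"
  using assms
proof (induction rule: walk_induct)
  case (Cons u x xs e es)
  then obtain ys where ys: "walk H (ys, es @ fs)" "hd ys = x" "last ys = last ws"
    by auto
  moreover from ys(1) obtain y zs where yz: "ys = y # zs"
    by (cases ys) (auto simp: walk_def)
  ultimately have "walk H (u # ys, (e # es) @ fs)" "hd (u # ys) = u" "last (u # ys) = last ws"
    using Cons by (auto simp: walk_Cons_iff)
  then show ?case
    by (metis list.sel(1))
qed auto

lemma walk_split:
  assumes "walk H (vs, es)" "v \<in> set vs"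
  shows "\<exists>as es1 bs es2. walk H (as, es1) \<and> walk H (bs, es2) \<and> es = es1 @ es2 \<and>
    hd as = hd vs \<and> last as = v \<and> hd bs = v \<and> last bs = last vs"
  using assms
proof (induction rule: walk_induct)
  case (Nil v')
  then have "walk H ([v], [])" "v = v'" by auto
  then show ?case
    by (intro exI[of _ "[v]"] exI[of _ "[]"]) auto
next
  case (Cons u x xs e es)
  show ?case
  proof (cases "v = u")
    case True
    have "walk H ([u], [])" "walk H (u # x # xs, e # es)"
      using Cons by (auto simp: walk_Cons_iff)
    with True show ?thesis
      by (intro exI[of _ "[u]"] exI[of _ "[]"] exI[of _ "u # x # xs"] exI[of _ "e # es"]) auto
  next
    case False
    then obtain as es1 bs es2 where
      w: "walk H (as, es1)" "walk H (bs, es2)" "es = es1 @ es2"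
        "hd as = x" "last as = v" "hd bs = v" "last bs = last (x # xs)"
      using Cons by auto
    from w(1,4) obtain zs where as: "as = x # zs"
      by (cases as) (auto simp: walk_def)
    have "walk H (u # as, e # es1)"
      using Cons w as by (auto simp: walk_Cons_iff)
    with w as show ?thesis
      by (intro exI[of _ "u # as"] exI[of _ "e # es1"] exI[of _ bs] exI[of _ es2]) auto
  qed
qed

lemma walk_mono:
  assumes "walk H w" "verts H \<subseteq> verts G" "edges H \<subseteq> edges G"
    and "\<And>e. e \<in> edges H \<Longrightarrow> ends H e \<subseteq> ends G e"
  shows "walk G w"
proof -
  obtain vs es where w: "w = (vs, es)" by fastforce
  with assms(1) have "walk H (vs, es)" by simp
  then have "walk G (vs, es)"
    by (induction rule: walk_induct) (use assms in \<open>auto simp: walk_Cons_iff\<close>)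
  with w show ?thesis by simp
qed

lemma walk_uncrossed:
  assumes "walk H (vs, es)"
    and "\<And>e. e \<in> edges H \<Longrightarrow> ends H e \<subseteq> A \<or> ends H e \<inter> A = {}"
  shows "hd vs \<in> A \<longleftrightarrow> last vs \<in> A"
  using assms(1)
proof (induction rule: walk_induct)
  case (Cons u x xs e es)
  then have "u \<in> A \<longleftrightarrow> x \<in> A" using assms(2)[of e] by blast
  with Cons show ?case by simp
qed simp

section \<open>Parity of degrees along a trail\<close>

definition degree :: "('v, 'e) pre_hypergraph \<Rightarrow> 'v \<Rightarrow> nat" where
  "degree G v = card {e \<in> edges G. v \<in> ends G e}"

definition graph :: "('v, 'e) pre_hypergraph \<Rightarrow> bool" where
  "graph G \<longleftrightarrow> hypergraph G \<and> (\<forall>e\<in>edges G. card (ends G e) = 2)"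

definition even_graph :: "('v, 'e) pre_hypergraph \<Rightarrow> bool" where
  "even_graph G \<longleftrightarrow> graph G \<and> (\<forall>v\<in>verts G. even (degree G v))"

lemma card_2_eq_doubleton: "card A = 2 \<Longrightarrow> u \<in> A \<Longrightarrow> x \<in> A \<Longrightarrow> u \<noteq> x \<Longrightarrow> A = {u, x}"
  by (auto simp: card_2_iff)

lemma graph_ends:
  "graph G \<Longrightarrow> e \<in> edges G \<Longrightarrow> u \<in> ends G e \<Longrightarrow> x \<in> ends G e \<Longrightarrow> u \<noteq> x \<Longrightarrow> ends G e = {u, x}"
  by (simp add: graph_def card_2_eq_doubleton)

text \<open>Prepending an edge \<open>{u, x}\<close> changes the parity of the degree exactly at its two ends, and moves the
  start of the trail from \<open>x\<close> to \<open>u\<close>. The closed case says that a circuit has even degrees;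
  the open case says that a trail which does not return has odd degree at its last vertex.\<close>

lemma trail_degree_parity:
  assumes "walk G (vs, es)" "graph G" "distinct es"
  shows "even (card {e \<in> set es. v \<in> ends G e}) \<longleftrightarrow> (v = hd vs \<longleftrightarrow> v = last vs)"
  using assms
proof (induction rule: walk_induct)
  case (Cons u x xs e es)
  have "ends G e = {u, x}"
    using Cons graph_ends by metis
  moreover have "{f \<in> set (e # es). v \<in> ends G f} =
      (if v \<in> ends G e then insert e {f \<in> set es. v \<in> ends G f} else {f \<in> set es. v \<in> ends G f})"
    by auto
  moreover have "e \<notin> {f \<in> set es. v \<in> ends G f}"
    using Cons.prems by auto
  ultimately show ?case
    using Cons by auto
qed auto

text \<open>In a graph, both elements of a traversed edge are anchors, whereas an edge of a hypergraph may have
  further elements that the walk misses.\<close>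

lemma graph_anchors:
  assumes "walk G w" "graph G" "\<not> trivial_walk w"
  shows "anchors w = \<Union> (ends G ` walk_edges w)"
proof -
  obtain vs es where w: "w = (vs, es)" by fastforce
  have "es \<noteq> [] \<Longrightarrow> set vs = \<Union> (ends G ` set es)" if "walk G (vs, es)" for vs es
    using that
  proof (induction rule: walk_induct)
    case (Cons u x xs e es)
    then have "ends G e = {u, x}"
      using assms(2) graph_ends by metis
    with Cons show ?case by (cases "es = []") auto
  qed auto
  with assms w show ?thesis
    by (simp add: anchors_def walk_edges_def trivial_walk_def)
qed

section \<open>Euler families of even graphs\<close>

definition circuit :: "('v, 'e) pre_hypergraph \<Rightarrow> ('v, 'e) walk \<Rightarrow> bool" where
  "circuit H w \<longleftrightarrow> strict_trail H w \<and> closed_walk w \<and> \<not> trivial_walk w"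

lemma circuit_mono:
  assumes "circuit H w" "verts H \<subseteq> verts G" "edges H \<subseteq> edges G"
    and "\<And>e. e \<in> edges H \<Longrightarrow> ends H e \<subseteq> ends G e"
  shows "circuit G w"
  using assms walk_mono[of H w G] by (auto simp: circuit_def strict_trail_def)

text \<open>A longest trail from \<open>u\<close> is closed: at any other last vertex it would use an odd number of edges,
  whereas their total number is even, so that an unused edge would prolong it.\<close>

lemma even_graph_circuit_exists:
  assumes "even_graph G" "edges G \<noteq> {}"
  shows "\<exists>w. circuit G w"
proof -
  have g: "graph G" and H: "hypergraph G" using assms by (auto simp: even_graph_def graph_def)
  obtain e where e: "e \<in> edges G" using assms by blast
  with g obtain u x where ux: "ends G e = {u, x}" "u \<noteq> x"
    by (auto simp: graph_def card_2_iff)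
  let ?P = "\<lambda>w. strict_trail G w \<and> hd (fst w) = u"
  have "{u, x} \<subseteq> verts G" using H e ux by (auto simp: hypergraph_def)
  then have start: "?P ([u, x], [e])"
    using e ux by (auto simp: strict_trail_def walk_Cons_iff)
  have bound: "length (snd w) < Suc (card (edges G))" if "?P w" for w
  proof -
    have "length (snd w) = card (set (snd w))" "set (snd w) \<subseteq> edges G"
      using that by (auto simp: strict_trail_def walk_def distinct_card split: prod.splits)
    then show ?thesis
      using H card_mono[of "edges G" "set (snd w)"] by (simp add: hypergraph_def)
  qed
  obtain w where w: "?P w" and max: "\<And>w'. ?P w' \<Longrightarrow> length (snd w') \<le> length (snd w)"
    using ex_has_greatest_nat[of ?P "([u, x], [e])" "\<lambda>w. length (snd w)" "Suc (card (edges G))"]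
      start bound by (metis less_imp_le)
  obtain vs es where vs: "w = (vs, es)" by fastforce
  have wk: "walk G (vs, es)" "distinct es" "hd vs = u" using w vs by (auto simp: strict_trail_def)
  have "last vs = u"
  proof (rule ccontr)
    let ?v = "last vs"
    assume ne: "?v \<noteq> u"
    have v: "?v \<in> verts G" and sub: "set es \<subseteq> edges G"
      using wk(1) by (cases vs; auto simp: walk_def)+
    have "odd (card {f \<in> set es. ?v \<in> ends G f})"
      using trail_degree_parity[OF wk(1) g wk(2), of ?v] ne wk(3) by auto
    moreover have "even (card {f \<in> edges G. ?v \<in> ends G f})"
      using assms v by (auto simp: even_graph_def degree_def)
    ultimately have "{f \<in> edges G. ?v \<in> ends G f} \<noteq> {f \<in> set es. ?v \<in> ends G f}"
      by metis
    then obtain f where f: "f \<in> edges G" "?v \<in> ends G f" "f \<notin> set es"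
      using sub by blast
    then have "card (ends G f) = 2" using g by (simp add: graph_def)
    then obtain y where y: "y \<in> ends G f" "y \<noteq> ?v"
      by (metis card_2_iff insertCI)
    have "y \<in> verts G" using H f y by (auto simp: hypergraph_def)
    then have "walk G ([?v, y], [f])" using f y v by (auto simp: walk_Cons_iff)
    then obtain xs where "walk G (xs, es @ [f])" "hd xs = u"
      using walk_append[OF wk(1)] wk(3) by force
    then have "?P (xs, es @ [f])" using wk f by (auto simp: strict_trail_def)
    from max[OF this] vs show False by simp
  qed
  moreover have "es \<noteq> []" using max[OF start] vs by auto
  ultimately show ?thesis
    using w vs wk by (auto simp: circuit_def closed_walk_def trivial_walk_def)
qed

text \<open>An Euler family without the condition that the trails be anchor-disjoint. Finiteness makes the
  number of trails a measure to be minimised.\<close>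

definition circuit_decomposition :: "('v, 'e) pre_hypergraph \<Rightarrow> ('v, 'e) walk set \<Rightarrow> bool" where
  "circuit_decomposition H T \<longleftrightarrow> finite T \<and> (\<forall>w\<in>T. circuit H w) \<and>
     (\<forall>w\<in>T. \<forall>w'\<in>T. w \<noteq> w' \<longrightarrow> walk_edges w \<inter> walk_edges w' = {}) \<and>
     \<Union> (walk_edges ` T) = edges H"

lemma circuit_edges: "circuit H w \<Longrightarrow> walk_edges w \<subseteq> edges H \<and> walk_edges w \<noteq> {}"
  by (auto simp: circuit_def strict_trail_def walk_def walk_edges_def trivial_walk_def
      split: prod.splits)

lemma even_graph_delete_circuit:
  assumes "even_graph G" "circuit G w"
  shows "even_graph (delete_edges G (walk_edges w))"
proof -
  obtain vs es where w: "w = (vs, es)" by fastforce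
  have g: "graph G" using assms by (simp add: even_graph_def)
  have wk: "walk G (vs, es)" "distinct es" "hd vs = last vs"
    using assms w by (auto simp: circuit_def strict_trail_def closed_walk_def)
  have sub: "set es \<subseteq> edges G" using wk(1) by (simp add: walk_def)
  have "even (degree (delete_edges G (set es)) v)" if v: "v \<in> verts G" for v
  proof -
    have "{e \<in> edges G - set es. v \<in> ends G e}
        = {e \<in> edges G. v \<in> ends G e} - {e \<in> set es. v \<in> ends G e}" by auto
    then have "degree (delete_edges G (set es)) v
        = card {e \<in> edges G. v \<in> ends G e} - card {e \<in> set es. v \<in> ends G e}"
      using sub by (simp add: degree_def delete_edges_def) (intro card_Diff_subset, auto)
    moreover have "even (card {e \<in> edges G. v \<in> ends G e})"
      using assms(1) v by (simp add: even_graph_def degree_def)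
    moreover have "even (card {e \<in> set es. v \<in> ends G e})"
      using trail_degree_parity[OF wk(1) g wk(2)] wk(3) by simp
    ultimately show ?thesis by simp
  qed
  with g w show ?thesis
    by (auto simp: even_graph_def graph_def hypergraph_def delete_edges_def walk_edges_def)
qed

lemma even_graph_circuit_decomposition:
  assumes "even_graph G"
  shows "\<exists>T. circuit_decomposition G T"
  using assms
proof (induction "card (edges G)" arbitrary: G rule: less_induct)
  case less
  show ?case
  proof (cases "edges G = {}")
    case True
    then have "circuit_decomposition G {}" by (simp add: circuit_decomposition_def)
    then show ?thesis ..
  next
    case False
    then obtain w where w: "circuit G w" using even_graph_circuit_exists less.prems by blast
    let ?G = "delete_edges G (walk_edges w)"
    have fin: "finite (edges G)"
      using less.prems by (simp add: even_graph_def graph_def hypergraph_def)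
    have E: "edges ?G = edges G - walk_edges w" by (simp add: delete_edges_def)
    have "card (edges ?G) < card (edges G)"
      using circuit_edges[OF w] fin unfolding E by (intro psubset_card_mono) auto
    then obtain T where T: "circuit_decomposition ?G T"
      using less.hyps even_graph_delete_circuit[OF less.prems w] by blast
    have mono: "circuit ?G w' \<Longrightarrow> circuit G w'" for w'
      by (erule circuit_mono) (auto simp: delete_edges_def)
    have "walk_edges w' \<inter> walk_edges w = {}" if "w' \<in> T" for w'
      using T that E circuit_edges[of ?G w'] by (auto simp: circuit_decomposition_def)
    then have "circuit_decomposition G (insert w T)"
      using T w mono E circuit_edges[OF w] by (fastforce simp: circuit_decomposition_def)
    then show ?thesis ..
  qed
qed

text \<open>The two pieces of the circuit before and after \<open>v\<close> are traversed in the opposite order.\<close>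

lemma circuit_start_anywhere:
  assumes "circuit H w" "v \<in> anchors w"
  shows "\<exists>w'. circuit H w' \<and> walk_edges w' = walk_edges w \<and> hd (fst w') = v"
proof -
  obtain vs es where w: "w = (vs, es)" by fastforce
  have wk: "walk H (vs, es)" "distinct es" "hd vs = last vs" "es \<noteq> []"
    using assms w by (auto simp: circuit_def strict_trail_def closed_walk_def trivial_walk_def)
  have "v \<in> set vs" using assms w by (simp add: anchors_def)
  from walk_split[OF wk(1) this] obtain as es1 bs es2 where
    s: "walk H (as, es1)" "walk H (bs, es2)" "es = es1 @ es2"
      "hd as = hd vs" "last as = v" "hd bs = v" "last bs = last vs"
    by blast
  have "last bs = hd as"
    using s wk(3) by simp
  from walk_append[OF s(2,1) this] obtain xs where
    "walk H (xs, es2 @ es1)" "hd xs = v" "last xs = v"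
    using s by auto
  then have "circuit H (xs, es2 @ es1) \<and> walk_edges (xs, es2 @ es1) = walk_edges w \<and>
      hd (fst (xs, es2 @ es1)) = v"
    using s wk w
    by (auto simp: circuit_def strict_trail_def closed_walk_def trivial_walk_def walk_edges_def)
  then show ?thesis by blast
qed

lemma circuit_merge:
  assumes "circuit H w" "circuit H w'" "walk_edges w \<inter> walk_edges w' = {}"
    and "anchors w \<inter> anchors w' \<noteq> {}"
  shows "\<exists>m. circuit H m \<and> walk_edges m = walk_edges w \<union> walk_edges w'"
proof -
  obtain v where "v \<in> anchors w" "v \<in> anchors w'" using assms(4) by blast
  then obtain c c' where
    c: "circuit H c" "walk_edges c = walk_edges w" "hd (fst c) = v" and
    c': "circuit H c'" "walk_edges c' = walk_edges w'" "hd (fst c') = v"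
    using circuit_start_anywhere assms(1,2) by metis
  obtain vs es where vs: "c = (vs, es)" by fastforce
  obtain ws fs where ws: "c' = (ws, fs)" by fastforce
  have 1: "walk H (vs, es)" "distinct es" "hd vs = v" "last vs = v" "es \<noteq> []"
    using c vs by (auto simp: circuit_def strict_trail_def closed_walk_def trivial_walk_def)
  have 2: "walk H (ws, fs)" "distinct fs" "hd ws = v" "last ws = v"
    using c' ws by (auto simp: circuit_def strict_trail_def closed_walk_def)
  obtain xs where xs: "walk H (xs, es @ fs)" "hd xs = v" "last xs = v"
    using walk_append[OF 1(1) 2(1)] 1 2 by auto
  have "set es \<inter> set fs = {}" using assms(3) c c' vs ws by (simp add: walk_edges_def)
  then have "circuit H (xs, es @ fs)"
    using xs 1 2 by (auto simp: circuit_def strict_trail_def closed_walk_def trivial_walk_def)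
  moreover have "walk_edges (xs, es @ fs) = walk_edges w \<union> walk_edges w'"
    using c c' vs ws by (simp add: walk_edges_def)
  ultimately show ?thesis by blast
qed

lemma circuit_decomposition_merge:
  assumes T: "circuit_decomposition H T" and w: "w \<in> T" "w' \<in> T" "w \<noteq> w'"
    and meet: "anchors w \<inter> anchors w' \<noteq> {}"
  shows "\<exists>T'. circuit_decomposition H T' \<and> card T' < card T"
proof -
  have fin: "finite T" using T by (simp add: circuit_decomposition_def)
  obtain m where m: "circuit H m" "walk_edges m = walk_edges w \<union> walk_edges w'"
    using circuit_merge[of H w w'] T w meet by (auto simp: circuit_decomposition_def)
  let ?R = "T - {w, w'}"
  have rest: "walk_edges r \<inter> walk_edges m = {}" if "r \<in> ?R" for r
    using T w that unfolding m(2) circuit_decomposition_def by blast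
  have "T = insert w (insert w' ?R)" using w by blast
  then have "\<Union> (walk_edges ` T) = walk_edges w \<union> (walk_edges w' \<union> \<Union> (walk_edges ` ?R))"
    by (metis Union_insert image_insert)
  then have "\<Union> (walk_edges ` insert m ?R) = edges H"
    using T m(2) by (auto simp: circuit_decomposition_def)
  then have "circuit_decomposition H (insert m ?R)"
    using T m(1) rest unfolding circuit_decomposition_def by blast
  moreover have "card (insert m ?R) < card T"
  proof -
    have "card ?R = card T - 2" using w fin by (simp add: card_Diff_subset)
    moreover have "card {w, w'} \<le> card T" using w fin by (intro card_mono) auto
    then have "2 \<le> card T" using w(3) by simp
    moreover have "card (insert m ?R) \<le> Suc (card ?R)" using fin by (simp add: card_insert_if)
    ultimately show ?thesis by linarith
  qed
  ultimately show ?thesis by blast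
qed

lemma euler_family_iff:
  "euler_family H T \<longleftrightarrow>
     (\<forall>w\<in>T. circuit H w) \<and>
     (\<forall>w\<in>T. \<forall>w'\<in>T. w \<noteq> w' \<longrightarrow>
        walk_edges w \<inter> walk_edges w' = {} \<and> anchors w \<inter> anchors w' = {}) \<and>
     \<Union> (walk_edges ` T) = edges H"
  (is "?L \<longleftrightarrow> ?C \<and> ?D \<and> ?U")
proof
  assume L: ?L
  then have C: ?C and D: ?D by (simp_all add: euler_family_def circuit_def)
  have "\<exists>w\<in>T. e \<in> walk_edges w" if "e \<in> edges H" for e
    using L that by (auto simp: euler_family_def)
  moreover have "walk_edges w \<subseteq> edges H" if "w \<in> T" for w
    using C circuit_edges that by blast
  ultimately have ?U by blast
  with C D show "?C \<and> ?D \<and> ?U" by simp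
next
  assume R: "?C \<and> ?D \<and> ?U"
  have "\<exists>!w\<in>T. e \<in> walk_edges w" if "e \<in> edges H" for e
  proof -
    obtain w where "w \<in> T" "e \<in> walk_edges w" using R \<open>e \<in> edges H\<close> by blast
    then show ?thesis using R by blast
  qed
  with R show ?L by (simp add: euler_family_def circuit_def)
qed

lemma euler_family_cover:
  "euler_family H T \<Longrightarrow> e \<in> edges H \<Longrightarrow> \<exists>w\<in>T. e \<in> walk_edges w"
  by (auto simp: euler_family_iff)

lemma euler_family_same_edge:
  "euler_family H T \<Longrightarrow> w \<in> T \<Longrightarrow> w' \<in> T \<Longrightarrow> e \<in> walk_edges w \<Longrightarrow> e \<in> walk_edges w' \<Longrightarrow> w = w'"
  by (metis disjoint_iff euler_family_iff)

lemma euler_family_same_anchor: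
  "euler_family H T \<Longrightarrow> w \<in> T \<Longrightarrow> w' \<in> T \<Longrightarrow> v \<in> anchors w \<Longrightarrow> v \<in> anchors w' \<Longrightarrow> w = w'"
  by (metis disjoint_iff euler_family_iff)

lemma circuitD:
  assumes "circuit H w"
  shows "walk H w" "distinct (snd w)" "\<not> trivial_walk w" "hd (fst w) = last (fst w)"
  using assms by (auto simp: circuit_def strict_trail_def closed_walk_def)

text \<open>In a circuit decomposition with the fewest members, two circuits with a common anchor could be
  merged; so the members are anchor-disjoint.\<close>

lemma even_graph_euler_family:
  assumes "even_graph G"
  shows "\<exists>T. euler_family G T"
proof -
  obtain T where T: "circuit_decomposition G T"
    and min: "\<And>T'. circuit_decomposition G T' \<Longrightarrow> card T \<le> card T'"
    using even_graph_circuit_decomposition[OF assms]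
      ex_has_least_nat[of "circuit_decomposition G" _ card] by blast
  have disj: "anchors w \<inter> anchors w' = {}" if "w \<in> T" "w' \<in> T" "w \<noteq> w'" for w w'
    using circuit_decomposition_merge[OF T that] min by (meson not_less)
  then have "euler_family G T"
    using T by (simp add: euler_family_iff circuit_decomposition_def)
  then show ?thesis ..
qed

text \<open>By anchor-disjointness all edges at a vertex belong to the same closed trail, which has even
  degrees.\<close>

lemma euler_family_even_degrees:
  assumes g: "graph G" and T: "euler_family G T"
  shows "even_graph G"
proof -
  have circ: "circuit G w" if "w \<in> T" for w
    using T that by (simp add: euler_family_iff)
  have anch: "anchors w = \<Union> (ends G ` walk_edges w)" if "w \<in> T" for w
    using graph_anchors[OF _ g] circuitD[OF circ[OF that]] by blast
  have "even (degree G v)" for v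
  proof (cases "\<exists>w\<in>T. v \<in> anchors w")
    case True
    then obtain w where w: "w \<in> T" "v \<in> anchors w" by blast
    have "e \<in> walk_edges w" if "e \<in> edges G" "v \<in> ends G e" for e
    proof -
      obtain w' where w': "w' \<in> T" "e \<in> walk_edges w'"
        using euler_family_cover[OF T \<open>e \<in> edges G\<close>] by blast
      then have "v \<in> anchors w'" using anch that(2) by blast
      then have "w' = w" using euler_family_same_anchor[OF T] w w' by blast
      with w' show ?thesis by simp
    qed
    then have "{e \<in> edges G. v \<in> ends G e} = {e \<in> walk_edges w. v \<in> ends G e}"
      using circuit_edges[OF circ[OF w(1)]] by blast
    moreover have "even (card {e \<in> set (snd w). v \<in> ends G e})"
      using trail_degree_parity[of G "fst w" "snd w" v] circuitD[OF circ[OF w(1)]] g by simp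
    ultimately show ?thesis by (simp add: degree_def walk_edges_def)
  next
    case False
    have "v \<notin> ends G e" if "e \<in> edges G" for e
    proof -
      obtain w' where "w' \<in> T" "e \<in> walk_edges w'"
        using euler_family_cover[OF T \<open>e \<in> edges G\<close>] by blast
      then show ?thesis using anch False by blast
    qed
    then have "{e \<in> edges G. v \<in> ends G e} = {}" by blast
    then show ?thesis by (simp only: degree_def card.empty even_zero)
  qed
  with g show ?thesis by (simp add: even_graph_def)
qed

lemma euler_family_anchors:
  assumes "graph G" "euler_family G T"
  shows "\<Union> (anchors ` T) = \<Union> (ends G ` edges G)"
proof -
  have "anchors w = \<Union> (ends G ` walk_edges w)" if "w \<in> T" for w
    using graph_anchors[OF _ assms(1)] circuitD[of G w] assms(2) that by (simp add: euler_family_iff)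
  then have "\<Union> (anchors ` T) = \<Union> (ends G ` \<Union> (walk_edges ` T))"
    by auto
  with assms(2) show ?thesis by (simp add: euler_family_iff)
qed

section \<open>Euler families as even selections\<close>

text \<open>What is left of an Euler family when the order of the steps is forgotten: between which two anchors
  each edge is traversed.\<close>

definition even_selection :: "('v, 'e) pre_hypergraph \<Rightarrow> ('e \<Rightarrow> 'v set) \<Rightarrow> bool" where
  "even_selection H g \<longleftrightarrow> (\<forall>e\<in>edges H. g e \<subseteq> ends H e) \<and> even_graph (H\<lparr>ends := g\<rparr>)"

text \<open>Every edge occurs at one place of one trail of the family; its pair consists of the anchors before
  and after that place.\<close>

lemma euler_family_selection:
  assumes H: "hypergraph H" and T: "euler_family H T"
  shows "\<exists>g. even_selection H g \<and> \<Union> (g ` edges H) = \<Union> (anchors ` T)"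
proof -
  have circ: "circuit H w" if "w \<in> T" for w
    using T that by (simp add: euler_family_iff)
  define at where "at e w i \<longleftrightarrow> w \<in> T \<and> i < length (snd w) \<and> snd w ! i = e" for e w i
  define g where "g e = {v. \<exists>w i. at e w i \<and> v \<in> {fst w ! i, fst w ! Suc i}}" for e
  let ?G = "H\<lparr>ends := g\<rparr>"
  have unique: "w' = w \<and> j = i" if "at e w i" "at e w' j" for e w i w' j
  proof -
    have "e \<in> walk_edges w" "e \<in> walk_edges w'"
      using that unfolding at_def walk_edges_def by (metis nth_mem)+
    then have "w' = w" using euler_family_same_edge[OF T] that by (auto simp: at_def)
    moreover have "distinct (snd w)" using circuitD[OF circ] that by (simp add: at_def)
    ultimately show ?thesis using that by (auto simp: at_def nth_eq_iff_index_eq)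
  qed
  have g: "g e = {fst w ! i, fst w ! Suc i}" if "at e w i" for e w i
    using unique[OF that] that unfolding g_def by blast
  have step: "fst w ! i \<noteq> fst w ! Suc i" "{fst w ! i, fst w ! Suc i} \<subseteq> ends H e"
    if "at e w i" for e w i
    using circuitD(1)[OF circ[of w]] that by (auto simp: at_def walk_def split: prod.splits)
  have ex: "\<exists>w i. at e w i" if "e \<in> edges H" for e
    using euler_family_cover[OF T that] unfolding at_def walk_edges_def by (metis in_set_conv_nth)
  have sub: "g e \<subseteq> ends H e" and two: "card (g e) = 2" if "e \<in> edges H" for e
  proof -
    obtain w i where "at e w i" using ex \<open>e \<in> edges H\<close> by blast
    then show "g e \<subseteq> ends H e" "card (g e) = 2" using g step by simp_all
  qed
  have "ends H e \<subseteq> verts H" if "e \<in> edges H" for e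
    using H that by (simp add: hypergraph_def)
  then have G: "graph ?G"
    using H sub two by (auto simp: graph_def hypergraph_def)
  have "circuit ?G w" if w: "w \<in> T" for w
  proof -
    have "at (snd w ! i) w i" if "i < length (snd w)" for i
      using w that by (simp add: at_def)
    then have "g (snd w ! i) = {fst w ! i, fst w ! Suc i}" if "i < length (snd w)" for i
      using g that by blast
    then show ?thesis
      using circ[OF w] by (auto simp: circuit_def strict_trail_def walk_def split: prod.splits)
  qed
  then have TG: "euler_family ?G T"
    using T by (simp add: euler_family_iff)
  with G sub show ?thesis
    using euler_family_even_degrees[OF G TG] euler_family_anchors[OF G TG]
    by (auto simp: even_selection_def)
qed

text \<open>A circuit of the selected graph is a circuit of the hypergraph, as the selected pairs lie inside the
  edges.\<close>

lemma selection_euler_family: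
  assumes "even_selection H g"
  shows "\<exists>T. euler_family H T \<and> \<Union> (anchors ` T) = \<Union> (g ` edges H)"
proof -
  let ?G = "H\<lparr>ends := g\<rparr>"
  have G: "even_graph ?G" "graph ?G" using assms by (auto simp: even_selection_def even_graph_def)
  obtain T where T: "euler_family ?G T" using even_graph_euler_family[OF G(1)] by blast
  have "circuit H w" if "circuit ?G w" for w
    using that by (rule circuit_mono) (use assms in \<open>auto simp: even_selection_def\<close>)
  then have "euler_family H T"
    using T by (simp add: euler_family_iff)
  with euler_family_anchors[OF G(2) T] show ?thesis by auto
qed

lemma has_euler_family_iff:
  assumes "hypergraph H"
  shows "has_euler_family H \<longleftrightarrow> (\<exists>g. even_selection H g)"
  unfolding has_euler_family_def
proof
  assume "\<exists>T. euler_family H T"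
  then show "\<exists>g. even_selection H g" using euler_family_selection[OF assms] by blast
next
  assume "\<exists>g. even_selection H g"
  then show "\<exists>T. euler_family H T" using selection_euler_family by blast
qed

lemma has_spanning_euler_family_iff:
  assumes "hypergraph H"
  shows "has_spanning_euler_family H \<longleftrightarrow>
    (\<exists>g. even_selection H g \<and> verts H \<subseteq> \<Union> (g ` edges H))"
proof -
  have "spanning_family H T \<longleftrightarrow> verts H \<subseteq> \<Union> (anchors ` T)" for T
    by (auto simp: spanning_family_def)
  then show ?thesis
    using euler_family_selection[OF assms] selection_euler_family
    unfolding has_spanning_euler_family_def by metis
qed

section \<open>Collapsing one side of a cut\<close>

lemma handshake:
  assumes "graph G"
  shows "(\<Sum>v\<in>verts G. degree G v) = 2 * card (edges G)"
  unfolding degree_def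
proof (rule sum_multicount)
  show "finite (verts G)" "finite (edges G)"
    using assms by (simp_all add: graph_def hypergraph_def)
  have "{v \<in> verts G. v \<in> ends G e} = ends G e" if "e \<in> edges G" for e
    using assms that by (auto simp: graph_def hypergraph_def)
  then show "\<forall>e\<in>edges G. card {v \<in> verts G. v \<in> ends G e} = 2"
    using assms by (simp add: graph_def)
qed

lemma even_graph_all_but_one:
  assumes "graph G" "v\<^sub>0 \<in> verts G" "\<And>v. v \<in> verts G - {v\<^sub>0} \<Longrightarrow> even (degree G v)"
  shows "even_graph G"
proof -
  have "finite (verts G)" using assms(1) by (simp add: graph_def hypergraph_def)
  then have "degree G v\<^sub>0 + (\<Sum>v\<in>verts G - {v\<^sub>0}. degree G v) = 2 * card (edges G)"
    using handshake[OF assms(1)] assms(2) by (simp add: sum.remove)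
  moreover have "even (\<Sum>v\<in>verts G - {v\<^sub>0}. degree G v)"
    using assms(3) by (intro dvd_sum) auto
  ultimately have "even (degree G v\<^sub>0)"
    by (metis dvd_add_left_iff dvd_triv_left)
  with assms show ?thesis by (auto simp: even_graph_def)
qed

lemma cut_complement:
  assumes "hypergraph H" "A \<subseteq> verts H"
  shows "cut H (verts H - A) = cut H A"
proof -
  have "verts H - (verts H - A) = A" using assms(2) by blast
  then show ?thesis by (auto simp: cut_def)
qed

text \<open>The set \<open>A\<close> is the side that is kept, and its complement \<open>B\<close> is collapsed. The assumptions are
  symmetric in the two sides, which allows instantiation of the locale at both.\<close>

locale pair_cut =
  fixes H :: "('v, 'e) pre_hypergraph" and A :: "'v set"
  assumes H: "hypergraph H"
    and A: "A \<subseteq> verts H"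
    and nonempty: "cut H A \<noteq> {}"
    and pairs: "\<And>e. e \<in> cut H A \<Longrightarrow> card (ends H e) = 2"
    and large: "\<And>e. e \<in> edges H \<Longrightarrow> 2 \<le> card (ends H e)"
begin

abbreviation "B \<equiv> verts H - A"

abbreviation "H' \<equiv> collapse H {B}"

definition proj :: "'v \<Rightarrow> 'v + 'v set" where
  "proj x = (if x \<in> A then Inl x else Inr B)"

lemma ends_subset: "e \<in> edges H \<Longrightarrow> ends H e \<subseteq> verts H"
  using H by (simp add: hypergraph_def)

lemma finite_ends: "e \<in> edges H \<Longrightarrow> finite (ends H e)"
  using ends_subset[of e] H finite_subset[of _ "verts H"] by (simp add: hypergraph_def)

lemma edge_cases:
  assumes "e \<in> edges H"
  obtains "ends H e \<subseteq> A" "ends H e \<inter> A \<noteq> {}" "e \<notin> cut H A"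
  | "ends H e \<inter> A = {}" "ends H e \<subseteq> B" "e \<notin> cut H A"
  | a b where "e \<in> cut H A" "a \<in> A" "b \<in> B" "ends H e = {a, b}"
proof -
  consider "ends H e \<subseteq> A" | "ends H e \<inter> A = {}" | "e \<in> cut H A"
    using assms ends_subset[OF assms] by (auto simp: cut_def)
  then show thesis
  proof cases
    case 1
    have "ends H e \<noteq> {}" using large[OF assms] by auto
    with 1 that(1) show ?thesis by (auto simp: cut_def)
  next
    case 2
    with that(2) ends_subset[OF assms] show ?thesis by (auto simp: cut_def)
  next
    case 3
    then obtain a b where ab: "a \<in> ends H e" "a \<in> A" "b \<in> ends H e" "b \<in> B"
      by (auto simp: cut_def)
    then have "ends H e = {a, b}"
      by (intro card_2_eq_doubleton[OF pairs[OF 3]]) auto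
    with 3 ab that(3) show ?thesis by blast
  qed
qed

lemma collapse_ends:
  assumes "e \<in> edges H"
  shows "ends H' e = proj ` ends H e"
proof -
  have "verts H - \<Union> {B} = A" using A by auto
  then have "ends H' e = Inl ` (ends H e \<inter> A) \<union> Inr ` {W \<in> {B}. ends H e \<inter> W \<noteq> {}}"
    by (simp only: collapse_def collapsed_ends_def pre_hypergraph.simps)
  also have "Inl ` (ends H e \<inter> A) = proj ` (ends H e \<inter> A)"
    by (rule image_cong) (auto simp: proj_def)
  also have "Inr ` {W \<in> {B}. ends H e \<inter> W \<noteq> {}} = proj ` (ends H e \<inter> B)"
    by (auto simp: proj_def)
  also have "proj ` (ends H e \<inter> A) \<union> proj ` (ends H e \<inter> B) = proj ` ends H e"
    using ends_subset[OF assms] by blast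
  finally show ?thesis .
qed

text \<open>The edges inside \<open>A\<close> are not affected by the collapse, and a cut edge has only one element in \<open>B\<close>;
  so no two elements of an edge that meets \<open>A\<close> are identified.\<close>

lemma proj_inj:
  assumes "e \<in> edges H" "ends H e \<inter> A \<noteq> {}"
  shows "inj_on proj (ends H e)"
  using assms(1)
proof (cases rule: edge_cases)
  case 1
  then show ?thesis by (auto simp: inj_on_def proj_def)
next
  case 2
  with assms(2) show ?thesis by simp
next
  case (3 a b)
  then show ?thesis by (auto simp: inj_on_def proj_def)
qed

text \<open>The discarded edges are those inside \<open>B\<close>, which shrink to a point; all others keep their size.\<close>

lemma collapse_edges: "edges H' = {e \<in> edges H. ends H e \<inter> A \<noteq> {}}"
proof -
  have "2 \<le> card (proj ` ends H e) \<longleftrightarrow> ends H e \<inter> A \<noteq> {}" if e: "e \<in> edges H" for e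
  proof (cases "ends H e \<inter> A = {}")
    case True
    then have "proj ` ends H e \<subseteq> {Inr B}" by (auto simp: proj_def)
    then have "card (proj ` ends H e) \<le> card {Inr B :: 'v + 'v set}"
      by (intro card_mono) simp_all
    with True show ?thesis by simp
  next
    case False
    with card_image[OF proj_inj[OF e False]] large[OF e] show ?thesis by simp
  qed
  moreover have "edges H' = {e \<in> edges H. 2 \<le> card (ends H' e)}"
    by (simp add: collapse_def)
  ultimately show ?thesis using collapse_ends by auto
qed

lemma collapse_verts: "verts H' = Inl ` A \<union> {Inr B}"
  using A by (auto simp: collapse_def)

lemma collapse_hypergraph: "hypergraph H'"
proof -
  have "finite A" using H A finite_subset by (auto simp: hypergraph_def)
  moreover have "finite (edges H)" using H by (simp add: hypergraph_def)
  moreover have "ends H' e \<subseteq> Inl ` A \<union> {Inr B}" if "e \<in> edges H" for e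
    using that by (auto simp: collapse_ends proj_def)
  ultimately show ?thesis
    by (auto simp: hypergraph_def collapse_verts collapse_edges)
qed

text \<open>No degree in \<open>A\<close> changes. Hence all degrees but that of the new vertex are known to be even, and
  the handshake lemma settles the remaining one.\<close>

lemma collapse_selection:
  assumes g: "even_selection H g"
  shows "even_selection H' (\<lambda>e. proj ` g e)"
proof -
  let ?G = "H'\<lparr>ends := \<lambda>e. proj ` g e\<rparr>"
  have sub: "g e \<subseteq> ends H e" and two: "card (g e) = 2" if "e \<in> edges H" for e
    using g that by (auto simp: even_selection_def even_graph_def graph_def)
  have sub': "proj ` g e \<subseteq> ends H' e" if "e \<in> edges H'" for e
    using sub that by (auto simp: collapse_edges collapse_ends)
  have "card (proj ` g e) = 2" if e: "e \<in> edges H'" for e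
  proof -
    have "inj_on proj (g e)"
      using e sub inj_on_subset[OF proj_inj, of e "g e"] by (simp add: collapse_edges)
    then show ?thesis using e two by (simp add: card_image collapse_edges)
  qed
  then have G: "graph ?G"
    using collapse_hypergraph sub' order_trans unfolding graph_def hypergraph_def
    by (simp, blast)
  have "even (degree ?G (Inl a))" if a: "a \<in> A" for a
  proof -
    have "{e \<in> edges ?G. Inl a \<in> proj ` g e} = {e \<in> edges H. a \<in> g e}"
      using sub a by (auto simp: collapse_edges proj_def image_iff split: if_splits)
    moreover have "even (degree (H\<lparr>ends := g\<rparr>) a)"
      using g a A by (auto simp: even_selection_def even_graph_def)
    ultimately show ?thesis by (simp add: degree_def)
  qed
  then have "even_graph ?G"
    by (intro even_graph_all_but_one[OF G, of "Inr B"]) (auto simp: collapse_verts)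
  with sub' show ?thesis by (simp add: even_selection_def)
qed

text \<open>The new vertex is reached by any cut edge, since both elements of a cut edge are selected.\<close>

lemma collapse_selection_spanning:
  assumes g: "even_selection H g" and span: "verts H \<subseteq> \<Union> (g ` edges H)"
  shows "verts H' \<subseteq> \<Union> ((\<lambda>e. proj ` g e) ` edges H')"
proof -
  have sub: "g e \<subseteq> ends H e" and two: "card (g e) = 2" if "e \<in> edges H" for e
    using g that by (auto simp: even_selection_def even_graph_def graph_def)
  have "\<exists>e\<in>edges H'. Inl a \<in> proj ` g e" if a: "a \<in> A" for a
  proof -
    obtain e where e: "e \<in> edges H" "a \<in> g e" using a A span by blast
    then have "e \<in> edges H'" "proj a \<in> proj ` g e"
      using sub[OF e(1)] a by (auto simp: collapse_edges)
    with a show ?thesis by (auto simp: proj_def)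
  qed
  moreover have "\<exists>e\<in>edges H'. Inr B \<in> proj ` g e"
  proof -
    obtain f where f: "f \<in> cut H A" using nonempty by blast
    then have fE: "f \<in> edges H" by (simp add: cut_def)
    then have "g f = ends H f"
      using sub two pairs[OF f] finite_ends by (intro card_subset_eq) auto
    with f fE show ?thesis
      by (intro bexI[of _ f]) (auto simp: cut_def collapse_edges proj_def image_iff)
  qed
  ultimately show ?thesis by (auto simp: collapse_verts)
qed

lemma has_euler_family_collapse: "has_euler_family H \<Longrightarrow> has_euler_family H'"
  using collapse_selection
  unfolding has_euler_family_iff[OF H] has_euler_family_iff[OF collapse_hypergraph] by blast

lemma has_spanning_euler_family_collapse:
  assumes "has_spanning_euler_family H"
  shows "has_spanning_euler_family H'"
proof -
  obtain g where g: "even_selection H g" "verts H \<subseteq> \<Union> (g ` edges H)"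
    using assms unfolding has_spanning_euler_family_iff[OF H] by blast
  show ?thesis
    unfolding has_spanning_euler_family_iff[OF collapse_hypergraph]
    using collapse_selection[OF g(1)] collapse_selection_spanning[OF g] by (intro exI conjI)
qed

text \<open>The part inside \<open>A\<close> of the pair that a selection of the collapsed hypergraph assigns to \<open>e\<close>. The case
  distinction makes it empty on the edges inside \<open>B\<close>: these are not edges of the collapsed
  hypergraph, and \<open>g\<close> may take any value on them.\<close>

definition lift :: "('e \<Rightarrow> ('v + 'v set) set) \<Rightarrow> 'e \<Rightarrow> 'v set" where
  "lift g e = (if ends H e \<inter> A = {} then {} else Inl -` g e)"

context
  fixes g assumes g: "even_selection H' g"
begin

lemma selection_edge:
  assumes "e \<in> edges H" "ends H e \<inter> A \<noteq> {}"
  shows "g e \<subseteq> proj ` ends H e" "card (g e) = 2"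
  using g assms collapse_ends[of e]
  by (auto simp: even_selection_def even_graph_def graph_def collapse_edges)

lemma lift_subset:
  assumes "e \<in> edges H"
  shows "lift g e \<subseteq> ends H e \<inter> A"
  using selection_edge(1)[OF assms] by (auto simp: lift_def proj_def split: if_splits)

lemma lift_inside:
  assumes "e \<in> edges H" "ends H e \<subseteq> A" "ends H e \<noteq> {}"
  shows "card (lift g e) = 2"
proof -
  have meets: "ends H e \<inter> A \<noteq> {}" using assms by blast
  have "g e \<subseteq> range Inl"
    using selection_edge(1)[OF assms(1) meets] assms(2) by (auto simp: proj_def)
  then have "card (Inl -` g e) = card (g e)"
    by (simp add: card_vimage_inj)
  with meets selection_edge(2)[OF assms(1) meets] show ?thesis by (simp add: lift_def)
qed

lemma lift_cut:
  assumes "e \<in> cut H A"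
  shows "lift g e = ends H e \<inter> A"
proof -
  have e: "e \<in> edges H" "ends H e \<inter> A \<noteq> {}" using assms by (auto simp: cut_def)
  have "card (proj ` ends H e) = 2"
    using proj_inj[OF e] pairs[OF assms] by (simp add: card_image)
  then have "g e = proj ` ends H e"
    using selection_edge[OF e] finite_ends[OF e(1)] by (intro card_subset_eq) auto
  with e show ?thesis by (auto simp: lift_def proj_def image_iff split: if_splits)
qed

lemma lift_even:
  assumes "a \<in> A"
  shows "even (card {e \<in> edges H. a \<in> lift g e})"
proof -
  have "{e \<in> edges H. a \<in> lift g e} = {e \<in> edges H'. Inl a \<in> g e}"
    by (auto simp: lift_def collapse_edges)
  moreover have "even (degree (H'\<lparr>ends := g\<rparr>) (Inl a))"
    using g assms by (simp add: even_selection_def even_graph_def collapse_verts)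
  ultimately show ?thesis by (simp add: degree_def)
qed

lemma lift_spanning:
  assumes "verts H' \<subseteq> \<Union> (g ` edges H')"
  shows "A \<subseteq> \<Union> (lift g ` edges H)"
proof
  fix a assume "a \<in> A"
  then obtain e where "e \<in> edges H'" "Inl a \<in> g e"
    using assms by (auto simp: collapse_verts)
  then have "e \<in> edges H" "a \<in> lift g e" by (auto simp: lift_def collapse_edges)
  then show "a \<in> \<Union> (lift g ` edges H)" by blast
qed

end

end

lemma pair_cut_complement:
  assumes "pair_cut H A"
  shows "pair_cut H (verts H - A)"
proof -
  interpret pair_cut H A by fact
  have same: "cut H (verts H - A) = cut H A" by (rule cut_complement[OF H A])
  show ?thesis
    by unfold_locales (use H nonempty pairs large in \<open>auto simp: same\<close>)
qed

text \<open>Each edge inside one side gets its pair from the selection on that side. A cut edge gets one element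
  from either selection, because each must select both ends of the collapsed edge; together they form that edge.\<close>

lemma glue_selections:
  assumes "pair_cut H A"
    and g: "even_selection (collapse H {verts H - A}) g"
    and k: "even_selection (collapse H {A}) k"
  shows "even_selection H (\<lambda>e. pair_cut.lift H A g e \<union> pair_cut.lift H (verts H - A) k e)"
proof -
  interpret L: pair_cut H A by fact
  interpret R: pair_cut H "verts H - A" by (rule pair_cut_complement) fact
  have AB: "verts H - (verts H - A) = A" using L.A by blast
  have k': "even_selection (collapse H {verts H - (verts H - A)}) k"
    using k by (simp only: AB)
  let ?h = "\<lambda>e. L.lift g e \<union> R.lift k e"
  have sub: "?h e \<subseteq> ends H e" if "e \<in> edges H" for e
    using L.lift_subset[OF g that] R.lift_subset[OF k' that] by blast
  have two: "card (?h e) = 2" if e: "e \<in> edges H" for e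
    using e
  proof (cases rule: L.edge_cases)
    case 1
    then have "R.lift k e = {}" using R.lift_subset[OF k' e] by blast
    with 1 show ?thesis using L.lift_inside[OF g e] by auto
  next
    case 2
    then have "L.lift g e = {}" using L.lift_subset[OF g e] by blast
    moreover have "ends H e \<noteq> {}" using L.large[OF e] by auto
    ultimately show ?thesis using 2 R.lift_inside[OF k' e] by auto
  next
    case (3 a b)
    then have "e \<in> cut H (verts H - A)" using cut_complement[OF L.H L.A] by simp
    then have "?h e = ends H e"
      using 3 L.lift_cut[OF g] R.lift_cut[OF k'] by auto
    then show ?thesis by (simp only: L.pairs[OF 3(1)])
  qed
  have "even (card {e \<in> edges H. v \<in> ?h e})" if v: "v \<in> verts H" for v
  proof (cases "v \<in> A")
    case True
    then have "{e \<in> edges H. v \<in> ?h e} = {e \<in> edges H. v \<in> L.lift g e}"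
      using R.lift_subset[OF k'] by blast
    then show ?thesis using L.lift_even[OF g True] by simp
  next
    case False
    then have "{e \<in> edges H. v \<in> ?h e} = {e \<in> edges H. v \<in> R.lift k e}"
      using L.lift_subset[OF g] by blast
    then show ?thesis using R.lift_even[OF k'] v False by simp
  qed
  moreover have "hypergraph (H\<lparr>ends := ?h\<rparr>)"
    using L.H sub L.ends_subset unfolding hypergraph_def by force
  ultimately show ?thesis
    using sub two by (simp add: even_selection_def even_graph_def graph_def degree_def)
qed

lemma euler_family_collapse:
  assumes "pair_cut H A"
  shows "has_euler_family H \<longleftrightarrow>
    has_euler_family (collapse H {verts H - A}) \<and> has_euler_family (collapse H {A})"
    (is ?euler)
    and "has_spanning_euler_family H \<longleftrightarrow>
    has_spanning_euler_family (collapse H {verts H - A}) \<and> has_spanning_euler_family (collapse H {A})"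
    (is ?spanning)
proof -
  interpret L: pair_cut H A by fact
  interpret R: pair_cut H "verts H - A" by (rule pair_cut_complement) fact
  have AB: "verts H - (verts H - A) = A" using L.A by blast
  have hyp: "hypergraph (collapse H {A})"
    using R.collapse_hypergraph by (simp only: AB)
  have right: "has_euler_family H \<Longrightarrow> has_euler_family (collapse H {A})"
    "has_spanning_euler_family H \<Longrightarrow> has_spanning_euler_family (collapse H {A})"
    using R.has_euler_family_collapse R.has_spanning_euler_family_collapse by (simp_all only: AB)
  show ?euler
  proof (intro iffI conjI)
    assume *: "has_euler_family L.H' \<and> has_euler_family (collapse H {A})"
    obtain g where g: "even_selection L.H' g"
      using * has_euler_family_iff[OF L.collapse_hypergraph] by blast
    obtain k where k: "even_selection (collapse H {A}) k"
      using * has_euler_family_iff[OF hyp] by blast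
    show "has_euler_family H"
      unfolding has_euler_family_iff[OF L.H] by (rule exI, rule glue_selections[OF assms g k])
  qed (rule L.has_euler_family_collapse right(1), assumption)+
  show ?spanning
  proof (intro iffI conjI)
    assume *: "has_spanning_euler_family L.H' \<and> has_spanning_euler_family (collapse H {A})"
    obtain g where g: "even_selection L.H' g" "verts L.H' \<subseteq> \<Union> (g ` edges L.H')"
      using * has_spanning_euler_family_iff[OF L.collapse_hypergraph] by blast
    obtain k where k: "even_selection (collapse H {A}) k"
        "verts (collapse H {A}) \<subseteq> \<Union> (k ` edges (collapse H {A}))"
      using * has_spanning_euler_family_iff[OF hyp] by blast
    have "A \<subseteq> \<Union> (L.lift g ` edges H)" by (rule L.lift_spanning[OF g])
    moreover have "verts H - A \<subseteq> \<Union> (R.lift k ` edges H)"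
      by (rule R.lift_spanning) (simp_all only: AB k)
    ultimately have "verts H \<subseteq> \<Union> ((\<lambda>e. L.lift g e \<union> R.lift k e) ` edges H)" by blast
    with glue_selections[OF assms g(1) k(1)] show "has_spanning_euler_family H"
      unfolding has_spanning_euler_family_iff[OF L.H] by (intro exI conjI)
  qed (rule L.has_spanning_euler_family_collapse right(2), assumption)+
qed

section \<open>The two components\<close>

text \<open>The component on the vertex set \<open>A\<close>. Empty edges, although contained in \<open>A\<close>, belong to no
  component.\<close>

definition side :: "('v, 'e) pre_hypergraph \<Rightarrow> 'e set \<Rightarrow> 'v set \<Rightarrow> ('v, 'e) pre_hypergraph" where
  "side H F A =
     \<lparr>verts = A, edges = {e \<in> edges H - F. ends H e \<noteq> {} \<and> ends H e \<subseteq> A}, ends = ends H\<rparr>"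

lemma side_simps [simp]:
  "verts (side H F A) = A"
  "edges (side H F A) = {e \<in> edges H - F. ends H e \<noteq> {} \<and> ends H e \<subseteq> A}"
  "ends (side H F A) = ends H"
  by (simp_all add: side_def)

locale minimal_pair_cut =
  fixes H :: "('v, 'e) pre_hypergraph" and F :: "'e set" and A :: "'v set"
  assumes H: "hypergraph H"
    and F_min: "minimal_edge_cut H F"
    and F_nonempty: "F \<noteq> {}"
    and F_pairs: "\<And>e. e \<in> F \<Longrightarrow> card (ends H e) = 2"
    and A_nonempty: "A \<noteq> {}"
    and A_proper: "A \<subset> verts H"
    and F_cut: "F = cut H A"
begin

lemma uncrossed: "e \<in> edges H \<Longrightarrow> e \<notin> F \<Longrightarrow> ends H e \<subseteq> A \<or> ends H e \<inter> A = {}"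
  using H by (auto simp: F_cut cut_def hypergraph_def)

lemma cut_within_F:
  assumes "X \<noteq> {}" "X \<subseteq> A" "cut H X \<subseteq> F"
  shows "cut H X = F"
proof -
  have "edge_cut H (cut H X)" using assms A_proper unfolding edge_cut_def by blast
  with assms(3) F_min show ?thesis by (auto simp: minimal_edge_cut_def)
qed

text \<open>A set \<open>X\<close> violating this would make both \<open>cut H X\<close> and \<open>cut H (A - X)\<close> subsets of \<open>F\<close>, hence equal to
  \<open>F\<close> by minimality. Then an edge of \<open>F\<close> would have at least three elements.\<close>

lemma side_inseparable:
  assumes X: "X \<noteq> {}" "X \<subset> A"
  shows "\<exists>e\<in>edges (side H F A). ends H e \<inter> X \<noteq> {} \<and> ends H e \<inter> (A - X) \<noteq> {}"
proof (rule ccontr)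
  assume none: "\<not> ?thesis"
  have "e \<in> F" if "e \<in> edges H" and meets: "Y = X \<or> Y = A - X" "ends H e \<inter> Y \<noteq> {}"
    and leaves: "\<not> ends H e \<subseteq> Y" for e Y
  proof (rule ccontr)
    assume "e \<notin> F"
    have "ends H e \<inter> A \<noteq> {}" using meets X by blast
    then have "ends H e \<subseteq> A" using uncrossed \<open>e \<in> edges H\<close> \<open>e \<notin> F\<close> by blast
    then have "e \<in> edges (side H F A)" using \<open>e \<in> edges H\<close> \<open>e \<notin> F\<close> meets(2) by auto
    moreover have "ends H e \<inter> X \<noteq> {} \<and> ends H e \<inter> (A - X) \<noteq> {}"
      using meets leaves \<open>ends H e \<subseteq> A\<close> by blast
    ultimately show False using none by blast
  qed
  then have "cut H X \<subseteq> F" "cut H (A - X) \<subseteq> F"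
    unfolding cut_def by blast+
  then have "cut H X = F" "cut H (A - X) = F"
    using X by (intro cut_within_F; blast)+
  moreover obtain f where f: "f \<in> F" using F_nonempty by blast
  ultimately have "ends H f \<inter> X \<noteq> {}" "ends H f \<inter> (A - X) \<noteq> {}" "ends H f \<inter> (verts H - A) \<noteq> {}"
    using F_cut unfolding cut_def by blast+
  then obtain x y z where "{x, y, z} \<subseteq> ends H f" "x \<in> X" "y \<in> A - X" "z \<notin> A"
    by blast
  then show False
    using F_pairs[OF f] card_mono[of "ends H f" "{x, y, z}"] X card_ge_0_finite[of "ends H f"]
    by (auto simp: card_insert_if split: if_splits)
qed

text \<open>The set \<open>X\<close> of the vertices that can be reached from \<open>u\<close> is all of \<open>A\<close>, since otherwise an edge leaves
  \<open>X\<close> within \<open>A\<close> and a walk can be prolonged along it.\<close>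

lemma side_connected: "connected_hypergraph (side H F A)"
  unfolding connected_hypergraph_def
proof (intro ballI)
  let ?K = "side H F A"
  fix u v assume "u \<in> verts ?K" "v \<in> verts ?K"
  then have u: "u \<in> A" and v: "v \<in> A" by simp_all
  define X where "X = {x. \<exists>vs es. walk ?K (vs, es) \<and> hd vs = u \<and> last vs = x}"
  have reachI: "x \<in> X" if "walk ?K (vs, es)" "hd vs = u" "last vs = x" for vs es x
    using that X_def by blast
  have "u \<in> X" by (rule reachI[of "[u]" "[]"]) (use u in simp_all)
  have "X \<subseteq> A"
  proof
    fix x assume "x \<in> X"
    then obtain vs es where w: "walk ?K (vs, es)" "last vs = x" by (auto simp: X_def)
    then have "vs \<noteq> []" "set vs \<subseteq> A" by (auto simp: walk_def)
    with w show "x \<in> A" by auto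
  qed
  have "X = A"
  proof (rule ccontr)
    assume "X \<noteq> A"
    then obtain e x y where e: "e \<in> edges ?K" "x \<in> ends H e" "x \<in> X" "y \<in> ends H e" "y \<in> A - X"
      using side_inseparable[of X] \<open>u \<in> X\<close> \<open>X \<subseteq> A\<close> by blast
    then obtain vs es where w: "walk ?K (vs, es)" "hd vs = u" "last vs = x"
      by (auto simp: X_def)
    have "walk ?K ([x, y], [e])"
      using e \<open>X \<subseteq> A\<close> by (auto simp: walk_Cons_iff)
    then obtain xs where "walk ?K (xs, es @ [e])" "hd xs = u" "last xs = y"
      using walk_append[OF w(1)] w by force
    then have "y \<in> X" by (rule reachI)
    with e show False by simp
  qed
  with v have "v \<in> X" by simp
  then obtain vs es where "walk ?K (vs, es)" "hd vs = u" "last vs = v"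
    unfolding X_def by blast
  then show "\<exists>w. walk ?K w \<and> hd (fst w) = u \<and> last (fst w) = v"
    by (intro exI[of _ "(vs, es)"]) simp
qed

lemma side_conn_sub: "conn_sub (side H F A) (delete_edges H F)"
proof -
  have "hypergraph (side H F A)"
    using H A_nonempty A_proper finite_subset by (auto simp: hypergraph_def)
  with side_connected A_proper show ?thesis
    by (auto simp: conn_sub_def subhypergraph_def delete_edges_def)
qed

lemma conn_sub_one_side:
  assumes "conn_sub C (delete_edges H F)"
  shows "subhypergraph C (side H F A) \<or> subhypergraph C (side H F (verts H - A))"
proof -
  have C: "hypergraph C" "verts C \<subseteq> verts H" "edges C \<subseteq> edges H - F" "ends C = ends H"
      "connected_hypergraph C" "\<forall>e\<in>edges C. ends H e \<noteq> {}"
    using assms by (auto simp: conn_sub_def subhypergraph_def delete_edges_def)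
  have same: "x \<in> A \<longleftrightarrow> y \<in> A" if xy: "x \<in> verts C" "y \<in> verts C" for x y
  proof -
    obtain vs es where "walk C (vs, es)" "hd vs = x" "last vs = y"
      using C(5) xy unfolding connected_hypergraph_def by force
    then show ?thesis
      using walk_uncrossed[of C vs es A] uncrossed C(3,4) by auto
  qed
  then have "verts C \<subseteq> A \<or> verts C \<subseteq> verts H - A" using C(2) by blast
  moreover have "subhypergraph C (side H F X)" if "verts C \<subseteq> X" for X
    using C that by (fastforce simp: subhypergraph_def hypergraph_def)
  ultimately show ?thesis by blast
qed

end

lemma minimal_pair_cut_complement:
  assumes "minimal_pair_cut H F A"
  shows "minimal_pair_cut H F (verts H - A)"
proof -
  interpret minimal_pair_cut H F A by fact
  have "A \<subseteq> verts H" using A_proper by (rule psubset_imp_subset)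
  from cut_complement[OF H this] have "F = cut H (verts H - A)"
    by (simp only: F_cut)
  moreover have "verts H - A \<noteq> {}" using A_proper by blast
  moreover have "verts H - A \<subset> verts H" using A_nonempty \<open>A \<subseteq> verts H\<close> by blast
  ultimately show ?thesis
    using H F_min F_nonempty F_pairs by (intro minimal_pair_cut.intro)
qed

lemma subhypergraph_trans:
  "subhypergraph C D \<Longrightarrow> subhypergraph D G \<Longrightarrow> subhypergraph C G"
  by (auto simp: subhypergraph_def)

lemma subhypergraph_antisym:
  "subhypergraph C D \<Longrightarrow> subhypergraph D C \<Longrightarrow> C = D"
  by (intro pre_hypergraph.equality) (auto simp: subhypergraph_def)

text \<open>Every connected subhypergraph lies in one of the two sides, and both sides are connected; so the
  sides are the maximal ones.\<close>

lemma components_sides: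
  assumes "minimal_pair_cut H F A"
  shows "components (delete_edges H F) = {side H F A, side H F (verts H - A)}"
proof -
  interpret L: minimal_pair_cut H F A by fact
  interpret R: minimal_pair_cut H F "verts H - A" by (rule minimal_pair_cut_complement) fact
  have max: "D = side H F X"
    if X: "X = A \<or> X = verts H - A" and D: "conn_sub D (delete_edges H F)" "subhypergraph (side H F X) D"
    for X D
  proof -
    obtain Y where Y: "Y = A \<or> Y = verts H - A" "subhypergraph D (side H F Y)"
      using L.conn_sub_one_side[OF D(1)] by blast
    have "X \<subseteq> Y" using subhypergraph_trans[OF D(2) Y(2)] by (simp add: subhypergraph_def)
    then have "X \<inter> Y = X" by (rule Int_absorb2)
    moreover have "X \<noteq> {}" using X L.A_nonempty R.A_nonempty by metis
    moreover have "X = Y \<or> X \<inter> Y = {}"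
      using X Y(1) Diff_disjoint[of A "verts H"] by (elim disjE) (simp_all add: Int_commute)
    ultimately have "X = Y" by simp
    with D(2) Y(2) show ?thesis by (auto intro: subhypergraph_antisym)
  qed
  have component: "side H F X \<in> components (delete_edges H F)"
    if X: "X = A \<or> X = verts H - A" for X
  proof -
    have "conn_sub (side H F X) (delete_edges H F)"
      using X L.side_conn_sub R.side_conn_sub by (elim disjE) simp_all
    moreover have "\<forall>D. conn_sub D (delete_edges H F) \<and> subhypergraph (side H F X) D \<longrightarrow>
        D = side H F X"
      by (intro allI impI) (elim conjE, rule max[OF X])
    ultimately show ?thesis unfolding components_def by (intro CollectI conjI)
  qed
  have "C = side H F A \<or> C = side H F (verts H - A)"
    if C: "C \<in> components (delete_edges H F)" for C
  proof -
    from C have all: "\<forall>D. conn_sub D (delete_edges H F) \<and> subhypergraph C D \<longrightarrow> D = C"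
      unfolding components_def by (elim CollectE conjE)
    have maxC: "D = C" if "conn_sub D (delete_edges H F)" "subhypergraph C D" for D
      using all that by blast
    have "side H F A = C" if "subhypergraph C (side H F A)"
      by (rule maxC[OF L.side_conn_sub that])
    moreover have "side H F (verts H - A) = C" if "subhypergraph C (side H F (verts H - A))"
      by (rule maxC[OF R.side_conn_sub that])
    moreover have "conn_sub C (delete_edges H F)"
      using C unfolding components_def by (elim CollectE conjE)
    ultimately show ?thesis
      using L.conn_sub_one_side by blast
  qed
  then have "components (delete_edges H F) \<subseteq> {side H F A, side H F (verts H - A)}"
    by blast
  with component show ?thesis by (simp add: subset_antisym)
qed

theorem theorem7p7p1:
  fixes H :: "('v, 'e) pre_hypergraph"
    and F :: "'e set"
    and I :: "('v, 'e) pre_hypergraph set"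
    and star :: "('v, 'e) pre_hypergraph \<Rightarrow> ('v + 'v set, 'e) pre_hypergraph"
  assumes "hypergraph H"
    and "minimal_edge_cut H F"
    and "F \<noteq> {}"
    and "\<forall>e\<in>F. card (ends H e) = 2"
    and "I = components (delete_edges H F)"
    and "\<forall>C\<in>I. star C = collapse H (verts ` (I - {C}))"
  shows "card I = 2 \<and>
    ((\<forall>e\<in>edges H. card (ends H e) \<ge> 2) \<longrightarrow>
       (has_euler_family H \<longleftrightarrow> (\<forall>C\<in>I. has_euler_family (star C))) \<and>
       (has_spanning_euler_family H \<longleftrightarrow> (\<forall>C\<in>I. has_spanning_euler_family (star C))))"
proof -
  obtain A where A: "A \<noteq> {}" "A \<subset> verts H" "F = cut H A"
    using assms(2) unfolding minimal_edge_cut_def edge_cut_def by (elim conjE exE)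
  let ?L = "side H F A" and ?R = "side H F (verts H - A)"
  have min: "minimal_pair_cut H F A"
    using assms(1-3) bspec[OF assms(4)] A by (intro minimal_pair_cut.intro)
  have I: "I = {?L, ?R}"
    unfolding assms(5) by (rule components_sides[OF min])
  have "A \<noteq> verts H - A" using A(1) by (metis Diff_disjoint Int_absorb)
  then have ne: "?L \<noteq> ?R" by (metis side_simps(1))
  then have "I - {?L} = {?R}" "I - {?R} = {?L}"
    by (simp_all add: I insert_Diff_if)
  moreover have "?L \<in> I" "?R \<in> I" by (simp_all add: I)
  ultimately have star: "star ?L = collapse H {verts H - A}" "star ?R = collapse H {A}"
    using bspec[OF assms(6), of ?L] bspec[OF assms(6), of ?R] by simp_all
  have "has_euler_family H \<longleftrightarrow> (\<forall>C\<in>I. has_euler_family (star C))"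
    and "has_spanning_euler_family H \<longleftrightarrow> (\<forall>C\<in>I. has_spanning_euler_family (star C))"
    if large: "\<forall>e\<in>edges H. card (ends H e) \<ge> 2"
  proof -
    have "pair_cut H A"
      by (rule pair_cut.intro) (use assms(1,3,4) A large in blast)+
    from euler_family_collapse[OF this]
    show "has_euler_family H \<longleftrightarrow> (\<forall>C\<in>I. has_euler_family (star C))"
      and "has_spanning_euler_family H \<longleftrightarrow> (\<forall>C\<in>I. has_spanning_euler_family (star C))"
      by (simp_all add: I star)
  qed
  with I ne show ?thesis by simp
qed

end
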